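(* Let $m\ge 0$ be an integer and $a=2^m$. Let $d_0,\dots,d_{a^2-1}$ be the difference sequence of the $(a,a)$ game, and let $(p_n,q_n)_{n\ge 0}$ be the sequence of pairs constructed from it as in the context. Then the sequence $(p_n,q_n)$ describes all P-positions of the $(a,a)$ game; that is, up to exchanging the two piles, the P-positions are exactly the pairs $(p_n,q_n)$: $$\{\text{P-positions of the }(a,a)\text{ game}\}=\{(p_n,q_n),(q_n,p_n): n\in\mathbb{Z}_{\ge 0}\}.$$
   Context: The $(a,a)$ game ($a$ a positive integer): positions are pairs $(x,y)\in\mathbb{Z}_{\ge 0}^2$ (sizes of two piles of stones). Two players alternate; a move removes any positive number of stones from one of the piles, or removes the same number $ka$ of stones from both piles, for some integer $k\ge 1$ (pile sizes must stay nonnegative). The player who removes the last stone wins. A P-position (cold position) is a position from which the player about to move cannot win under optimal play; equivalently, every move from it leads to a non-P-position (so $(0,0)$ is a P-position). Positions $(x,y)$ and $(y,x)$ are regarded as the same up to switching piles. Difference sequence of the $(a,a)$ game: each column $\{(i,y): y\ge 0\}$ contains exactly one P-position $(i,y_i)$; for $0\le i\le a^2-1$ put $d_i=y_i-i$. For a set $S$ of nonnegative integers, $\operatorname{mex} S$ is the least nonnegative integer not in $S$ (so $\operatorname{mex}\emptyset=0$). Define recursively for $n\ge 0$ $$P_n=\operatorname{mex}\{P_i,Q_i: 0\le i<n\},\qquad Q_n=P_n+a\left\lfloor \frac{n}{a^2}\right\rfloor .$$ Then define $p_n=P_n$ and $q_n=Q_{n+d_j}$, where $j\in\{0,\dots,a^2-1\}$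 is determined by $n\equiv j \pmod{a^2}$. *)

theory Defs
  imports Main
begin

section \<open>The game\<close>

type_synonym position = "nat \<times> nat"

inductive move :: "nat \<Rightarrow> position \<Rightarrow> position \<Rightarrow> bool" for a :: nat where
  first_pile: "1 \<le> s \<Longrightarrow> s \<le> x \<Longrightarrow> move a (x, y) (x - s, y)"
| second_pile: "1 \<le> s \<Longrightarrow> s \<le> y \<Longrightarrow> move a (x, y) (x, y - s)"
| both_piles: "1 \<le> k \<Longrightarrow> k * a \<le> x \<Longrightarrow> k * a \<le> y \<Longrightarrow> move a (x, y) (x - k * a, y - k * a)"

text \<open>
  The player about to move can force a win: some move leads to a position from which every
  reply of the opponent is again a position with a forced win. If the opponent has no reply,
  the last stone has just been taken; this is the base case of the induction.
\<close>

inductive can_win :: "nat \<Rightarrow> position \<Rightarrow> bool" for a :: nat where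
  "move a u v \<Longrightarrow> (\<And>w. move a v w \<Longrightarrow> can_win a w) \<Longrightarrow> can_win a u"

definition P_position :: "nat \<Rightarrow> position \<Rightarrow> bool" where
  "P_position a u \<longleftrightarrow> \<not> can_win a u"

lemma move_decreases:
  assumes "0 < a" "move a u v"
  shows "fst v + snd v < fst u + snd u"
  using assms(2)
proof cases
  case (both_piles k x y)
  have "0 < k * a" using both_piles assms(1) by simp
  then have "x - k * a < x" "y - k * a \<le> y" using both_piles by linarith+
  then show ?thesis using both_piles by simp
qed auto

theorem P_position_iff:
  assumes a: "0 < a"
  shows "P_position a u \<longleftrightarrow> (\<forall>v. move a u v \<longrightarrow> \<not> P_position a v)"
proof -
  have "\<not> can_win a u \<longleftrightarrow> (\<forall>v. move a u v \<longrightarrow> can_win a v)"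
  proof (induction "fst u + snd u" arbitrary: u rule: less_induct)
    case less
    show ?case
    proof
      assume u: "\<not> can_win a u"
      show "\<forall>v. move a u v \<longrightarrow> can_win a v"
      proof (intro allI impI)
        fix v assume v: "move a u v"
        then obtain w where w: "move a v w" "\<not> can_win a w"
          using u can_win.intros by blast
        have "fst w + snd w < fst u + snd u"
          using move_decreases[OF a v] move_decreases[OF a w(1)] by simp
        then show "can_win a v"
          using less w can_win.intros by blast
      qed
    next
      assume u: "\<forall>v. move a u v \<longrightarrow> can_win a v"
      show "\<not> can_win a u"
      proof
        assume "can_win a u"
        then obtain v where v: "move a u v" "\<And>w. move a v w \<Longrightarrow> can_win a w"
          by (auto elim: can_win.cases)
        then have "\<not> can_win a v" using less[OF move_decreases[OF a v(1)]] by blast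
        then show False using u v(1) by blast
      qed
    qed
  qed
  then show ?thesis by (simp add: P_position_def)
qed

section \<open>The difference sequence\<close>

lemma P_position_column_unique:
  assumes a: "0 < a" and P: "P_position a (i, y)" "P_position a (i, z)"
  shows "y = z"
proof (rule ccontr)
  assume "y \<noteq> z"
  then have "move a (i, y) (i, z) \<or> move a (i, z) (i, y)"
    using second_pile[of "y - z" y a i] second_pile[of "z - y" z a i]
    by (cases "y < z") auto
  then show False using P P_position_iff[OF a] by blast
qed

theorem ex1_P_position_in_column:
  assumes a: "0 < a"
  shows "\<exists>!y. P_position a (i, y)"
proof -
  have "\<exists>y. P_position a (i, y)"
  proof (rule ccontr)
    assume none: "\<nexists>y. P_position a (i, y)"
    define c where "c j = (THE z. P_position a (j, z))" for j
    have c: "c j = z" if "P_position a (j, z)" for j z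
      unfolding c_def using that P_position_column_unique[OF a] by blast
    have "y \<in> c ` {..<i} \<union> (\<lambda>j. c j + (i - j)) ` {..<i}" for y
    proof -
      obtain v where v: "move a (i, y) v" "P_position a v"
        using none P_position_iff[OF a, of "(i, y)"] by blast
      from v(1) show ?thesis
      proof cases
        case (first_pile s)
        then have "c (i - s) = y" "i - s < i" using v(2) c by auto
        then show ?thesis by blast
      next
        case (second_pile s)
        then show ?thesis using none v(2) by blast
      next
        case (both_piles k)
        then have "c (i - k * a) = y - k * a" using v(2) c by auto
        moreover have "0 < k * a" using both_piles a by simp
        ultimately have "y = c (i - k * a) + (i - (i - k * a))" "i - k * a < i"
          using both_piles by linarith+
        then show ?thesis by blast
      qed
    qed
    then have "(UNIV :: nat set) \<subseteq> c ` {..<i} \<union> (\<lambda>j. c j + (i - j)) ` {..<i}"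
      by blast
    moreover have "finite (c ` {..<i} \<union> (\<lambda>j. c j + (i - j)) ` {..<i})" by simp
    ultimately show False using finite_subset infinite_UNIV_nat by blast
  qed
  then show ?thesis using P_position_column_unique[OF a] by blast
qed

definition column_P :: "nat \<Rightarrow> nat \<Rightarrow> nat" where
  "column_P a i = (THE y. P_position a (i, y))"

definition diff_seq :: "nat \<Rightarrow> nat \<Rightarrow> int" where
  "diff_seq a i = int (column_P a i) - int i"

section \<open>The sequence of pairs\<close>

definition mex :: "nat set \<Rightarrow> nat" where
  "mex S = (LEAST n. n \<notin> S)"

function P_seq :: "nat \<Rightarrow> nat \<Rightarrow> nat" and Q_seq :: "nat \<Rightarrow> nat \<Rightarrow> nat" where
  "P_seq a n = mex (P_seq a ` {i. i < n} \<union> Q_seq a ` {i. i < n})"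
| "Q_seq a n = P_seq a n + a * (n div a\<^sup>2)"
  by pat_completeness auto
termination
  by (relation "measure (\<lambda>x. case x of Inl (a, n) \<Rightarrow> 2 * n | Inr (a, n) \<Rightarrow> 2 * n + 1)") auto

declare P_seq.simps [simp del] Q_seq.simps [simp del]

definition p_seq :: "nat \<Rightarrow> nat \<Rightarrow> nat" where
  "p_seq a n = P_seq a n"

text \<open>
  The index is computed in the integers, since entries of the difference sequence can be
  negative. The truncation by \<^const>\<open>nat\<close> is harmless: with \<open>j = n mod a\<^sup>2 \<le> n\<close> the index is
  \<open>n - j + column_P a j \<ge> 0\<close>.
\<close>

definition q_seq :: "nat \<Rightarrow> nat \<Rightarrow> nat" where
  "q_seq a n = Q_seq a (nat (int n + diff_seq a (n mod a\<^sup>2)))"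

lemma q_seq_index_nonneg: "0 \<le> int n + diff_seq a (n mod a\<^sup>2)"
proof -
  have "n mod a\<^sup>2 \<le> n" by simp
  then show ?thesis unfolding diff_seq_def by linarith
qed

end

theory Submission
  imports Defs
begin

text \<open>
  Write \<open>n = N a + r\<close> with \<open>r < a\<close>. Since \<open>a\<close> divides all the gaps \<open>a \<lfloor>n / a\<^sup>2\<rfloor>\<close>, the
  sequences \<open>P\<close> and \<open>Q\<close> are made of blocks of length \<open>a\<close>: \<open>P\<^sub>n = a A\<^sub>N + r\<close> and
  \<open>Q\<^sub>n = a (A\<^sub>N + \<lfloor>N / a\<rfloor>) + r\<close>, where \<open>A\<^sub>N\<close> solves the Wythoff-like recursion for the
  gaps \<open>\<lfloor>N / a\<rfloor>\<close>. For a power of two, \<open>x \<mapsto> x XOR s\<close> permutes \<open>{0..<a}\<close> for every \<open>s < a\<close>,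
  and the cold positions are, up to order, the pairs of \<open>a A\<^sub>N + r\<close> and
  \<open>a (A\<^sub>N + \<lfloor>N / a\<rfloor>) + (r XOR (N mod a))\<close>. Diagonal moves keep both residues modulo \<open>a\<close>,
  hence they keep \<open>N mod a\<close>, and the difference of the quotients determines \<open>N div a\<close>;
  so no diagonal move joins two cold positions. Conversely, from a position that is not cold
  one reaches a cold one, as in Wythoff's game; if both quotients already match the same \<open>N\<close>,
  then the move is the winning move of Nim on \<open>x mod a\<close>, \<open>y mod a\<close>, \<open>N mod a\<close>, where
  decreasing the third pile is a diagonal move.
\<close>

unbundle bit_operations_syntax

section \<open>Minimal excluded values and the Wythoff-like block sequences\<close>

lemma mex_eqI:
  assumes "n \<notin> S" "\<And>k. k < n \<Longrightarrow> k \<in> S"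
  shows "mex S = n"
  unfolding mex_def using assms by (intro Least_equality) (auto simp: not_less[symmetric])

lemma mex_notin:
  assumes "finite S"
  shows "mex S \<notin> S"
  unfolding mex_def using ex_new_if_finite[OF infinite_UNIV_nat assms] by (rule LeastI_ex)

lemma less_mex_in: "k < mex S \<Longrightarrow> k \<in> S"
  unfolding mex_def using not_less_Least by blast

text \<open>\<open>low\<close> is the block sequence \<open>A\<^sub>N\<close>; the gap is inlined so
  that the recursion does not involve \<open>high\<close>.\<close>

function low :: "nat \<Rightarrow> nat \<Rightarrow> nat" where
  "low a n = mex (low a ` {i. i < n} \<union> (\<lambda>i. low a i + i div a) ` {i. i < n})"
  by pat_completeness auto
termination by (relation "measure snd") auto

declare low.simps [simp del]

definition high :: "nat \<Rightarrow> nat \<Rightarrow> nat" where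
  "high a n = low a n + n div a"

lemma low_eq_mex: "low a n = mex (low a ` {..<n} \<union> high a ` {..<n})"
  by (subst low.simps) (simp add: high_def[abs_def] lessThan_def)

lemma low_neq:
  assumes "i < n"
  shows "low a n \<noteq> low a i" "low a n \<noteq> high a i"
proof -
  have "low a n \<notin> low a ` {..<n} \<union> high a ` {..<n}"
    by (subst low_eq_mex, rule mex_notin) simp
  then show "low a n \<noteq> low a i" "low a n \<noteq> high a i" using assms by auto
qed

lemma less_low_cases:
  assumes "k < low a n"
  obtains i where "i < n" "k = low a i \<or> k = high a i"
  using less_mex_in[of k] assms unfolding low_eq_mex[of a n] by blast

text \<open>A value of \<open>low\<close> at \<open>n\<close> below the one at an earlier
  \<open>i\<close> would lie under the mex taken at \<open>i\<close>, hence be used already before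
  \<open>i\<close>, against its freshness at \<open>n\<close>.\<close>

lemma strict_mono_low: "strict_mono (low a)"
proof (rule strict_monoI, rule ccontr)
  fix i n :: nat
  assume "i < n" "\<not> low a i < low a n"
  then have "low a n < low a i" using low_neq(1)[of i n a] by linarith
  then obtain l where "l < i" "low a n = low a l \<or> low a n = high a l"
    by (rule less_low_cases)
  then show False using low_neq[of l n a] \<open>i < n\<close> by auto
qed

text \<open>Both sequences increase strictly and \<open>low\<close> avoids all earlier values; a
  later \<open>high\<close> value exceeds earlier \<open>low\<close> values because gaps are
  nonnegative.\<close>

lemma low_high_index_eq:
  assumes "k = low a i \<or> k = high a i" "k = low a n \<or> k = high a n"
  shows "i = n"
proof -
  have "False" if "i < n" "k = low a i \<or> k = high a i" "k = low a n \<or> k = high a n" for i n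
  proof -
    have "low a i < low a n" using strict_mono_low that(1) by (rule strict_monoD)
    moreover have "high a i < high a n"
      using \<open>low a i < low a n\<close> that(1) div_le_mono[of i n a] unfolding high_def by linarith
    ultimately show False
      using that low_neq[of i n a] unfolding high_def by auto
  qed
  from this[of i n] this[of n i] show ?thesis using assms by (meson linorder_neqE_nat)
qed

lemma low_high_cover: obtains n where "k = low a n \<or> k = high a n"
proof -
  have "k < low a (Suc k)"
    using strict_mono_imp_increasing[OF strict_mono_low, of "Suc k" a] by simp
  then show ?thesis using less_low_cases that by blast
qed

text \<open>The gaps vanish on the first \<open>a\<close> indices, so \<open>low\<close> and
  \<open>high\<close> coincide there.\<close>

lemma low_eq_self: "n < a \<Longrightarrow> low a n = n"
proof (induction n rule: less_induct)
  case (less n)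
  show ?case
    by (subst low_eq_mex, rule mex_eqI) (use less in \<open>auto simp: high_def\<close>)
qed

section \<open>Block structure of the sequences P and Q\<close>

text \<open>The gap \<open>a * (n div a\<^sup>2)\<close> is \<open>a\<close> times the gap at block
  index \<open>n div a\<close>, so comparing quotients and residues modulo \<open>a\<close> reduces
  the mex to the one defining \<open>low\<close>.\<close>

lemma P_seq_Q_seq_eq:
  assumes a: "0 < a"
  shows "P_seq a n = a * low a (n div a) + n mod a"
    and "Q_seq a n = a * high a (n div a) + n mod a"
proof -
  show P: "P_seq a n = a * low a (n div a) + n mod a" for n
  proof (induction n rule: less_induct)
    case (less n)
    let ?S = "P_seq a ` {i. i < n} \<union> Q_seq a ` {i. i < n}"
    have P: "P_seq a i = a * low a (i div a) + i mod a" if "i < n" for i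
      using less that by blast
    have Q: "Q_seq a i = a * high a (i div a) + i mod a" if "i < n" for i
      using P[OF that] by (simp add: Q_seq.simps high_def div_mult2_eq power2_eq_square algebra_simps)
    have "mex ?S = a * low a (n div a) + n mod a"
    proof (rule mex_eqI)
      have "False" if i: "i < n"
        and eq: "a * low a (n div a) + n mod a = a * k + i mod a"
        and k: "k = low a (i div a) \<or> k = high a (i div a)" for i k
      proof -
        have "(a * low a (n div a) + n mod a) div a = low a (n div a)"
          "(a * k + i mod a) div a = k"
          "(a * low a (n div a) + n mod a) mod a = n mod a"
          "(a * k + i mod a) mod a = i mod a" using a by simp_all
        then have "low a (n div a) = k" "n mod a = i mod a" using eq by metis+
        then have "n div a = i div a" using low_high_index_eq k by metis
        then show False using \<open>n mod a = i mod a\<close> i by (metis div_mult_mod_eq less_irrefl)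
      qed
      then show "a * low a (n div a) + n mod a \<notin> ?S" using P Q by auto
    next
      fix y assume y: "y < a * low a (n div a) + n mod a"
      have ydm: "y = a * (y div a) + y mod a" by simp
      have r: "y mod a < a" "n mod a < a" using a by auto
      have "y div a \<le> (a * low a (n div a) + n mod a) div a" using y by (simp add: div_le_mono)
      then have "y div a \<le> low a (n div a)" using a by simp
      then consider "y div a < low a (n div a)" | "y div a = low a (n div a)" by linarith
      then show "y \<in> ?S"
      proof cases
        case 1
        then obtain j where j: "j < n div a" "y div a = low a j \<or> y div a = high a j"
          by (rule less_low_cases)
        \<comment> \<open>The index in block \<open>j\<close> with the residue of \<open>y\<close>;
          since \<open>j < n div a\<close>, this whole block of indices precedes
          \<open>n\<close>.\<close>
        define i where "i = a * j + y mod a"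
        have "a * Suc j \<le> a * (n div a)" using j(1) by (intro mult_le_mono2) simp
        also have "\<dots> \<le> n" by simp
        finally have "i < n" using r(1) unfolding i_def by simp
        have "i div a = j" "i mod a = y mod a" using a unfolding i_def by simp_all
        then have "y = P_seq a i \<or> y = Q_seq a i" using P Q \<open>i < n\<close> j(2) ydm by metis
        then show ?thesis using \<open>i < n\<close> by blast
      next
        case 2
        define i where "i = a * (n div a) + y mod a"
        have "y mod a < n mod a" using y ydm 2 by (metis nat_add_left_cancel_less)
        then have "i < n" unfolding i_def by (metis add_strict_left_mono mult_div_mod_eq)
        have "i div a = n div a" "i mod a = y mod a" using a unfolding i_def by simp_all
        then have "y = P_seq a i" using P \<open>i < n\<close> 2 ydm by metis
        then show ?thesis using \<open>i < n\<close> by blast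
      qed
    qed
    then show ?case by (subst P_seq.simps)
  qed
  show "Q_seq a n = a * high a (n div a) + n mod a"
    using P[of n] by (simp add: Q_seq.simps high_def div_mult2_eq power2_eq_square algebra_simps)
qed

section \<open>Cold positions and XOR\<close>

definition cold :: "nat \<Rightarrow> nat \<Rightarrow> nat \<Rightarrow> bool" where
  "cold a x y \<longleftrightarrow> (\<exists>n. (x mod a) XOR (y mod a) = n mod a \<and>
     (x div a = low a n \<and> y div a = high a n \<or> x div a = high a n \<and> y div a = low a n))"

lemma cold_sym: "cold a x y \<longleftrightarrow> cold a y x"
  unfolding cold_def by (simp add: xor.commute) blast

lemma xor_left_cancel_nat: "(r::nat) XOR s = r XOR t \<longleftrightarrow> s = t"
  by (metis xor.assoc xor_self_eq xor.left_neutral)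

text \<open>XOR acts bitwise and so creates no bit beyond the first \<open>m\<close>. This closure
  is what the power of two provides.\<close>

lemma xor_less_exp_nat:
  assumes "(r::nat) < 2 ^ m" "s < 2 ^ m"
  shows "r XOR s < 2 ^ m"
  using assms by (metis take_bit_nat_eq_self_iff take_bit_xor)

text \<open>The winning strategy of Nim on the three piles \<open>r, s, u\<close>: a nonzero nim-sum is cancelled by shrinking one pile.\<close>

lemma nim_three_piles:
  assumes "(r::nat) XOR s \<noteq> u"
  shows "s XOR u < r \<or> r XOR u < s \<or> r XOR s < u"
  using assms
proof (induction "r + s + u" arbitrary: r s u rule: less_induct)
  case less
  have xor2: "(v XOR w) div 2 = (v div 2) XOR (w div 2)" for v w :: nat
    using drop_bit_xor[of 1 v w] by (simp add: drop_bit_eq_div)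
  have div2: "v < w" if "v div 2 < w div 2" for v w :: nat
    using that by (meson div_le_mono not_less)
  have parity: "v < w" if "v div 2 = w div 2" "even v" "odd w" for v w :: nat
    using that by (metis le_neq_implies_less div_mult_mod_eq even_iff_mod_2_eq_zero le_add1 add_0_right)
  have "r + s + u \<noteq> 0" using less.prems by auto
  then have dec: "r div 2 + s div 2 + u div 2 < r + s + u" by linarith
  show ?case
  \<comment> \<open>If the halves already have nim-sum zero, only the lowest bits disagree: some odd
    pile faces an even XOR of the other two, and clearing its lowest bit suffices.\<close>
  proof (cases "(r div 2) XOR (s div 2) = u div 2")
    case False
    then show ?thesis using less.hyps[OF dec] xor2 div2 by metis
  next
    case True
    then have halves: "(r XOR s) div 2 = u div 2" "(r XOR u) div 2 = s div 2"
      "(s XOR u) div 2 = r div 2"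
      unfolding xor2 by (metis xor.assoc xor.commute xor_self_eq xor.right_neutral)+
    have "even (r XOR s) \<noteq> even u"
    proof
      assume "even (r XOR s) = even u"
      then have "(r XOR s) mod 2 = u mod 2" by (simp add: mod2_eq_if)
      then have "r XOR s = u" using halves(1) by (metis div_mult_mod_eq)
      then show False using less.prems by simp
    qed
    then consider "odd u" "even (r XOR s)" | "odd s" "even (r XOR u)" | "odd r" "even (s XOR u)"
      by (auto simp: even_xor_iff)
    then show ?thesis using halves parity by cases metis+
  qed
qed

section \<open>No move joins two cold positions\<close>

text \<open>The quotient of \<open>x\<close> fixes the block index; cancelling in the XOR then fixes
  the residue of the partner.\<close>

lemma cold_column_unique:
  assumes "cold a x y" "cold a x z"
  shows "y = z"
proof -
  obtain n where n: "(x mod a) XOR (y mod a) = n mod a"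
    "x div a = low a n \<and> y div a = high a n \<or> x div a = high a n \<and> y div a = low a n"
    using assms(1) unfolding cold_def by blast
  obtain k where k: "(x mod a) XOR (z mod a) = k mod a"
    "x div a = low a k \<and> z div a = high a k \<or> x div a = high a k \<and> z div a = low a k"
    using assms(2) unfolding cold_def by blast
  have "n = k" using n(2) k(2) low_high_index_eq by metis
  have "y mod a = z mod a"
    using n(1) k(1) \<open>n = k\<close> xor_left_cancel_nat by metis
  moreover have "y div a = z div a" using n(2) k(2) \<open>n = k\<close> by auto
  ultimately show ?thesis by (metis div_mult_mod_eq)
qed

lemma cold_diagonal_unique:
  assumes a: "0 < a" and c: "cold a x y" "cold a (x + k * a) (y + k * a)"
  shows "k = 0"
proof -
  obtain n where n: "(x mod a) XOR (y mod a) = n mod a"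
    "x div a = low a n \<and> y div a = high a n \<or> x div a = high a n \<and> y div a = low a n"
    using c(1) unfolding cold_def by blast
  obtain l where l: "(x mod a) XOR (y mod a) = l mod a"
    "x div a + k = low a l \<and> y div a + k = high a l \<or> x div a + k = high a l \<and> y div a + k = low a l"
    using c(2) a unfolding cold_def by (auto simp: add.commute)
  \<comment> \<open>The shift preserves the signed difference of the quotients; opposite orders of
    \<open>low\<close> and \<open>high\<close> force both gaps to be zero.\<close>
  have "n div a = l div a" using n(2) l(2) unfolding high_def by auto
  then have "n = l" using n(1) l(1) by (metis div_mult_mod_eq)
  then show ?thesis using n(2) l(2) unfolding high_def by auto
qed

lemma cold_not_move_cold:
  assumes "0 < a" "cold a x y" "move a (x, y) (x', y')"
  shows "\<not> cold a x' y'"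
  using assms(3)
proof cases
  case (first_pile s)
  then show ?thesis using cold_column_unique[of a y x x'] cold_sym assms(2) by auto
next
  case (second_pile s)
  then show ?thesis using cold_column_unique[of a x y y'] assms(2) by auto
next
  case (both_piles k)
  then have xy: "x' + k * a = x" "y' + k * a = y" by auto
  show ?thesis
  proof
    assume "cold a x' y'"
    then have "k = 0" using cold_diagonal_unique[of a x' y' k] assms(1,2) xy by simp
    then show False using both_piles(3) by simp
  qed
qed

section \<open>Reaching a cold position from any other position\<close>

lemma move_swap: "move a (x, y) (x', y') \<Longrightarrow> move a (y, x) (y', x')"
  by (erule move.cases) (auto intro: move.intros)

lemma move_second: "y' < y \<Longrightarrow> move a (x, y) (x, y')"
  using second_pile[of "y - y'" y a x] by simp

lemma move_first: "x' < x \<Longrightarrow> move a (x, y) (x', y)"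
  using first_pile[of "x - x'" x a y] by simp

lemma not_cold_move_cold_ordered:
  assumes a: "a = 2 ^ m" and nc: "\<not> cold a x y" and le: "x div a \<le> y div a"
  shows "\<exists>x' y'. move a (x, y) (x', y') \<and> cold a x' y'"
proof -
  have a0: "0 < a" using a by simp
  define r t where "r = x mod a" and "t = y mod a"
  have rt: "r < a" "t < a" using a0 by (auto simp: r_def t_def)
  have xy: "x = a * (x div a) + r" "y = a * (y div a) + t" by (auto simp: r_def t_def)
  have xl: "r XOR (r XOR v) = v" for v
    by (metis xor.assoc xor_self_eq xor.left_neutral)
  have xt: "(t XOR v) XOR t = v" for v
    by (metis xor.commute xor.assoc xor_self_eq xor.right_neutral)
  obtain n where n: "x div a = low a n \<or> x div a = high a n" by (rule low_high_cover)
  define u where "u = n mod a"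
  have u: "u < a" using a0 by (simp add: u_def)
  have ru: "r XOR u < a" "t XOR u < a" "r XOR t < a"
    using rt u xor_less_exp_nat unfolding a by auto
  have below: "a * i + v < a * j + w" if "i < j" "v < a" for i j v w
  proof -
    have "a * Suc i \<le> a * j" using that(1) by (intro mult_le_mono2) simp
    then show ?thesis using that(2) by simp
  qed
  show ?thesis
  proof (cases "x div a = low a n")
    case False
    \<comment> \<open>Here the gap at \<open>n\<close> is positive, so the block
      \<open>low a n\<close> lies strictly below that of \<open>y\<close>.\<close>
    define y' where "y' = a * low a n + (r XOR u)"
    have d: "y' div a = low a n" "y' mod a = r XOR u" using ru by (auto simp: y'_def)
    have "cold a x y'" unfolding cold_def using False n d xl
      by (intro exI[of _ n]) (simp add: r_def[symmetric] u_def[symmetric])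
    moreover have "y' < y" unfolding y'_def by (subst xy(2), rule below)
      (use False n le ru in \<open>auto simp: high_def\<close>)
    ultimately show ?thesis using move_second by blast
  next
    case low: True
    define y' where "y' = a * high a n + (r XOR u)"
    define x' where "x' = a * low a n + (t XOR u)"
    \<comment> \<open>The index a cold pair must have to share the residues and the quotient
      difference of \<open>(x, y)\<close>; its \<open>low\<close> block is below that of
      \<open>x\<close> once \<open>k < n\<close>.\<close>
    define k where "k = a * (y div a - x div a) + (r XOR t)"
    have k: "k div a = y div a - x div a" "k mod a = r XOR t" using ru by (auto simp: k_def)
    have "y' div a = high a n" "y' mod a = r XOR u" using ru by (auto simp: y'_def)
    then have cold_y': "cold a x y'" unfolding cold_def using low xl
      by (intro exI[of _ n]) (simp add: r_def[symmetric] u_def[symmetric])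
    have "x' div a = low a n" "x' mod a = t XOR u" using ru by (auto simp: x'_def)
    then have cold_x': "cold a x' y" if "y div a = high a n" unfolding cold_def using that xt
      by (intro exI[of _ n]) (simp add: t_def[symmetric] u_def[symmetric])
    have diagonal: ?thesis if "k < n"
    proof -
      define l where "l = x div a - low a k"
      have "low a k < low a n" using strict_mono_low that by (rule strict_monoD)
      then have l: "1 \<le> l" "x div a = low a k + l" unfolding l_def low by simp_all
      have yk: "y div a = high a k + l" using l(2) le k(1) unfolding high_def by simp
      have xk: "x = a * low a k + r + l * a" "y = a * high a k + t + l * a"
        using xy unfolding l(2) yk by (simp_all add: algebra_simps)
      have "cold a (a * low a k + r) (a * high a k + t)" unfolding cold_def using rt k
        by (intro exI[of _ k]) simp
      moreover have "move a (x, y) (a * low a k + r, a * high a k + t)"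
        using both_piles[of l a x y] l(1) unfolding xk by simp
      ultimately show ?thesis by blast
    qed
    consider "high a n < y div a" | "y div a < high a n" | "y div a = high a n" by linarith
    then show ?thesis
    proof cases
      case 1
      then have "y' < y" unfolding y'_def by (subst xy(2), intro below) (use ru in auto)
      then show ?thesis using cold_y' move_second by blast
    next
      case 2
      have "k div a < n div a" using 2 le low unfolding k(1) high_def by linarith
      then have "k < n" by (meson div_le_mono not_less)
      then show ?thesis by (rule diagonal)
    next
      case 3
      \<comment> \<open>Both quotients match index \<open>n\<close>, so only the residues fail and
        the three-pile Nim move applies.\<close>
      have "r XOR t \<noteq> u"
        using nc low 3 unfolding cold_def r_def t_def u_def by blast
      then consider "t XOR u < r" | "r XOR u < t" | "r XOR t < u"
        using nim_three_piles by blast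
      then show ?thesis
      proof cases
        case 1
        then have "x' < x" unfolding x'_def using xy(1) low by simp
        then show ?thesis using cold_x' 3 move_first by blast
      next
        case 2
        then have "y' < y" unfolding y'_def using xy(2) 3 by simp
        then show ?thesis using cold_y' move_second by blast
      next
        case u_large: 3
        have "k div a = n div a" unfolding k(1) 3 low high_def by simp
        then have "k < n" using u_large k(2) unfolding u_def
          by (metis div_mult_mod_eq nat_add_left_cancel_less)
        then show ?thesis by (rule diagonal)
      qed
    qed
  qed
qed

lemma not_cold_move_cold:
  assumes "a = 2 ^ m" "\<not> cold a x y"
  shows "\<exists>x' y'. move a (x, y) (x', y') \<and> cold a x' y'"
proof (cases "x div a \<le> y div a")
  case True
  then show ?thesis using not_cold_move_cold_ordered assms by blast
next
  case False
  then have "\<exists>y' x'. move a (y, x) (y', x') \<and> cold a y' x'"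
    using not_cold_move_cold_ordered[OF assms(1), of y x] assms(2) cold_sym by simp
  then show ?thesis using move_swap cold_sym by blast
qed

section \<open>P-positions and the sequence of pairs\<close>

text \<open>Both predicates hold exactly where no move leads back into them, and moves shrink the
  total.\<close>

lemma P_position_iff_cold:
  assumes a: "a = 2 ^ m"
  shows "P_position a (x, y) \<longleftrightarrow> cold a x y"
proof (induction "x + y" arbitrary: x y rule: less_induct)
  case less
  have a0: "0 < a" using a by simp
  have IH: "P_position a (x', y') \<longleftrightarrow> cold a x' y'" if "move a (x, y) (x', y')" for x' y'
    using less.hyps move_decreases[OF a0 that] by simp
  have "P_position a (x, y) \<longleftrightarrow> (\<forall>x' y'. move a (x, y) (x', y') \<longrightarrow> \<not> cold a x' y')"
    using IH by (subst P_position_iff[OF a0]) auto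
  also have "\<dots> \<longleftrightarrow> cold a x y"
    using cold_not_move_cold[OF a0] not_cold_move_cold[OF a] by blast
  finally show ?case .
qed

text \<open>For these columns the block index \<open>j div a\<close> is below \<open>a\<close>, so
  the gap is zero and the partner lies in the same block.\<close>

lemma column_P_eq:
  assumes a: "a = 2 ^ m" and j: "j < a\<^sup>2"
  shows "column_P a j = a * (j div a) + ((j mod a) XOR (j div a))"
proof -
  have a0: "0 < a" using a by simp
  have s: "j div a < a" using j by (simp add: less_mult_imp_div_less power2_eq_square)
  have x: "(j mod a) XOR (j div a) < a"
    using xor_less_exp_nat[of "j mod a" m "j div a"] s a0 a by simp
  have "cold a j (a * (j div a) + ((j mod a) XOR (j div a)))"
    unfolding cold_def using s x
    by (intro exI[of _ "j div a"]) (simp add: low_eq_self high_def flip: xor.assoc)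
  then show ?thesis unfolding column_P_def
    using P_position_iff_cold[OF a] cold_column_unique by (intro the_equality) blast+
qed

lemma p_seq_eq: "0 < a \<Longrightarrow> p_seq a n = a * low a (n div a) + n mod a"
  unfolding p_seq_def by (rule P_seq_Q_seq_eq)

lemma q_seq_eq:
  assumes a: "a = 2 ^ m"
  shows "q_seq a n = a * high a (n div a) + ((n mod a) XOR (n div a mod a))"
proof -
  have a0: "0 < a" using a by simp
  define j where "j = n mod a\<^sup>2"
  define w where "w = (n mod a) XOR (n div a mod a)"
  have w: "w < a" using xor_less_exp_nat[of "n mod a" m "n div a mod a"] a0 a unfolding w_def by simp
  have jeq: "j = a * (n div a mod a) + n mod a"
    unfolding j_def power2_eq_square by (rule mod_mult2_eq)
  then have "j div a = n div a mod a" "j mod a = n mod a" using a0 by simp_all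
  moreover have "j < a\<^sup>2" using a0 unfolding j_def by simp
  ultimately have "column_P a j = a * (n div a mod a) + w"
    using column_P_eq[OF a, of j] unfolding w_def by simp
  then have "diff_seq a j = int w - int (n mod a)"
    unfolding diff_seq_def by (simp add: jeq)
  moreover have "int n = int a * int (n div a) + int (n mod a)"
    by (metis of_nat_add of_nat_mult mult_div_mod_eq)
  \<comment> \<open>Adding the difference only permutes residues: the shifted index keeps the
    quotient \<open>n div a\<close>.\<close>
  ultimately have "int n + diff_seq a j = int (a * (n div a) + w)"
    unfolding of_nat_add of_nat_mult by linarith
  then have "q_seq a n = Q_seq a (a * (n div a) + w)"
    unfolding q_seq_def j_def[symmetric] by (metis nat_int)
  also have "\<dots> = a * high a (n div a) + w"
    using P_seq_Q_seq_eq(2)[OF a0] w by simp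
  finally show ?thesis unfolding w_def .
qed

theorem theorem3p1:
  fixes m a :: nat
  assumes "a = 2 ^ m"
  shows "{u. P_position a u} =
    {(p_seq a n, q_seq a n) | n. True} \<union> {(q_seq a n, p_seq a n) | n. True}"
proof -
  have a0: "0 < a" using assms by simp
  have cold_iff: "cold a x y \<longleftrightarrow>
    (\<exists>n. x = p_seq a n \<and> y = q_seq a n) \<or> (\<exists>n. x = q_seq a n \<and> y = p_seq a n)" for x y
  proof -
    have half: "(\<exists>n. (x mod a) XOR (y mod a) = n mod a \<and> x div a = low a n \<and> y div a = high a n) \<longleftrightarrow>
      (\<exists>n. x = p_seq a n \<and> y = q_seq a n)" (is "?L \<longleftrightarrow> ?R") for x y
    proof
      assume ?L
      then obtain n where n: "(x mod a) XOR (y mod a) = n mod a"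
        "x div a = low a n" "y div a = high a n" by blast
      \<comment> \<open>The block index \<open>n\<close> and the residue of the \<open>low\<close>
        member together recover the index of the pair.\<close>
      define i where "i = a * n + x mod a"
      have i: "i div a = n" "i mod a = x mod a" using a0 by (simp_all add: i_def)
      have "(x mod a) XOR (n mod a) = y mod a"
        unfolding n(1)[symmetric] by (simp flip: xor.assoc)
      then have "x = p_seq a i" "y = q_seq a i"
        unfolding p_seq_eq[OF a0] q_seq_eq[OF assms] i n(2,3)[symmetric] by simp_all
      then show ?R by blast
    next
      assume ?R
      then obtain n where n: "x = p_seq a n" "y = q_seq a n" by blast
      have "(n mod a) XOR (n div a mod a) < a"
        using xor_less_exp_nat[of "n mod a" m "n div a mod a"] a0 assms by simp
      then show ?L unfolding n p_seq_eq[OF a0] q_seq_eq[OF assms]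
        by (intro exI[of _ "n div a"]) (simp flip: xor.assoc)
    qed
    have "cold a x y \<longleftrightarrow>
      (\<exists>n. (x mod a) XOR (y mod a) = n mod a \<and> x div a = low a n \<and> y div a = high a n) \<or>
      (\<exists>n. (y mod a) XOR (x mod a) = n mod a \<and> y div a = low a n \<and> x div a = high a n)"
      unfolding cold_def by (subst (2) xor.commute) blast
    then show ?thesis unfolding half by blast
  qed
  show ?thesis
    by (auto simp: P_position_iff_cold[OF assms] cold_iff)
qed

end
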